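(* Let $R$ be a unital non-associative ring and let $\sigma:R\to R$ be an additive bijection such that $\sigma(1)=1$. If $R$ is right Noetherian and right quasi-associative, then the non-associative skew Laurent series ring $R((X;\sigma))$ is right Noetherian.
   Context: A non-associative ring is an additive abelian group with a multiplication that is left and right distributive over addition and not necessarily associative; it is unital if it has a two-sided multiplicative identity $1$. A right ideal of a non-associative ring $R$ is an additive subgroup $I$ with $ir\in I$ for all $i\in I$, $r\in R$. $R$ is right Noetherian if it satisfies the ascending chain condition on right ideals (equivalently, every right ideal is finitely generated as a right ideal). $R$ is right quasi-associative if for all $r,b,c\in R$ there exists $s\in R$ such that $(rb)c=rs$. For a unital non-associative ring $R$ and an additive bijection $\sigma:R\to R$ with $\sigma(1)=1$, the ring $R((X;\sigma))$ is the set of formal Laurent series $\sum_{i=n}^\infty r_iX^i$ with $n\in\mathbb{Z}$ and $r_i\in R$, with coefficientwise addition and multiplication induced by $(rX^m)(sX^n)=(r\sigma^m(s))X^{m+n}$ for $m,n\in\mathbb{Z}$, i.e. $\left(\sum_{i\ge n} r_iX^i\right)\left(\sum_{j\ge m} s_jX^j\right)=\sum_{k=n+m}^\infty\left(\sum_{i=n}^{k-m} r_i\sigma^i(s_{k-i})\right)X^k$. It is again a (generally not associative) unital non-associative ring. *)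

theory Defs
  imports "HOL-Computational_Algebra.Formal_Laurent_Series"
begin

(* No type class of the library has a distributive multiplication that need not be associative.
   The multiplication is therefore an explicit operation on a type of class ab_group_add, so that
   the same notions apply to R and to R((X;sigma)). The zero ring is not excluded. *)

locale nonassoc_ring_1 =
  fixes mul :: "'a::ab_group_add \<Rightarrow> 'a \<Rightarrow> 'a"
    and one :: 'a
  assumes distrib_left: "mul a (b + c) = mul a b + mul a c"
    and distrib_right: "mul (a + b) c = mul a c + mul b c"
    and one_left: "mul one a = a"
    and one_right: "mul a one = a"

definition right_ideal :: "('a::ab_group_add \<Rightarrow> 'a \<Rightarrow> 'a) \<Rightarrow> 'a set \<Rightarrow> bool" where
  "right_ideal mul I \<longleftrightarrow>
     0 \<in> I \<and> (\<forall>a\<in>I. \<forall>b\<in>I. a + b \<in> I) \<and> (\<forall>a\<in>I. - a \<in> I) \<and> (\<forall>a\<in>I. \<forall>r. mul a r \<in> I)"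

definition right_noetherian :: "('a::ab_group_add \<Rightarrow> 'a \<Rightarrow> 'a) \<Rightarrow> bool" where
  "right_noetherian mul \<longleftrightarrow>
     (\<forall>J :: nat \<Rightarrow> 'a set. (\<forall>n. right_ideal mul (J n)) \<and> (\<forall>n. J n \<subseteq> J (Suc n)) \<longrightarrow>
        (\<exists>N. \<forall>n\<ge>N. J n = J N))"

definition right_quasi_associative :: "('a \<Rightarrow> 'a \<Rightarrow> 'a) \<Rightarrow> bool" where
  "right_quasi_associative mul \<longleftrightarrow> (\<forall>r b c. \<exists>s. mul (mul r b) c = mul r s)"

definition int_funpow :: "int \<Rightarrow> ('a \<Rightarrow> 'a) \<Rightarrow> 'a \<Rightarrow> 'a" where
  "int_funpow i \<sigma> = (if 0 \<le> i then \<sigma> ^^ nat i else inv \<sigma> ^^ nat (- i))"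

(* The additive group of R((X;sigma)) is that of the library type of formal Laurent series; only
   the multiplication is twisted. *)

definition skew_fls_mult ::
  "('a::ab_group_add \<Rightarrow> 'a \<Rightarrow> 'a) \<Rightarrow> ('a \<Rightarrow> 'a) \<Rightarrow> 'a fls \<Rightarrow> 'a fls \<Rightarrow> 'a fls" where
  "skew_fls_mult mul \<sigma> f g =
     Abs_fls (\<lambda>k. \<Sum>i = fls_subdegree f..k - fls_subdegree g.
       mul (fls_nth f i) (int_funpow i \<sigma> (fls_nth g (k - i))))"

lemma fls_nth_skew_fls_mult:
  "fls_nth (skew_fls_mult mul \<sigma> f g) k =
     (\<Sum>i = fls_subdegree f..k - fls_subdegree g.
       mul (fls_nth f i) (int_funpow i \<sigma> (fls_nth g (k - i))))"
  unfolding skew_fls_mult_def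
  by (rule nth_Abs_fls_lower_bound[of "fls_subdegree f + fls_subdegree g"]) auto

lemma additive_int_funpow:
  assumes "additive \<sigma>" "bij \<sigma>"
  shows "additive (int_funpow i \<sigma>)"
proof -
  have funpow: "additive (f ^^ n)" if "additive f" for f :: "'a \<Rightarrow> 'a" and n
  proof (induction n)
    case 0
    show ?case by (simp add: additive_def)
  next
    case (Suc n)
    then show ?case using that by (simp add: additive_def)
  qed
  have "inv \<sigma> (x + y) = inv \<sigma> x + inv \<sigma> y" for x y
  proof -
    have "\<sigma> (inv \<sigma> x + inv \<sigma> y) = x + y"
      using assms by (simp add: additive.add bij_is_surj surj_f_inv_f)
    then show ?thesis
      using assms(2) by (metis bij_inv_eq_iff)
  qed
  then have "additive (inv \<sigma>)" by (simp add: additive_def)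
  with assms(1) show ?thesis by (simp add: int_funpow_def funpow)
qed

lemma int_funpow_fixpoint:
  assumes "bij \<sigma>" "\<sigma> x = x"
  shows "int_funpow i \<sigma> x = x"
proof -
  have "(f ^^ n) x = x" if "f x = x" for f :: "'a \<Rightarrow> 'a" and n
    using that by (induction n) auto
  moreover have "inv \<sigma> x = x"
    using assms by (metis bij_inv_eq_iff)
  ultimately show ?thesis using assms(2) by (simp add: int_funpow_def)
qed

context nonassoc_ring_1
begin

lemma mult_0_left: "mul 0 a = 0"
  using distrib_right[of 0 0 a] by simp

lemma mult_0_right: "mul a 0 = 0"
  using distrib_left[of a 0 0] by simp

(* The summation bounds may be any lower bounds of the supports, as in the textbook formula. *)
lemma fls_nth_skew_fls_mult_bounds:
  assumes "additive \<sigma>" "bij \<sigma>"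
    and f: "\<And>i. i < n \<Longrightarrow> fls_nth f i = 0" and g: "\<And>j. j < m \<Longrightarrow> fls_nth g j = 0"
  shows "fls_nth (skew_fls_mult mul \<sigma> f g) k =
    (\<Sum>i = n..k - m. mul (fls_nth f i) (int_funpow i \<sigma> (fls_nth g (k - i))))"
proof -
  let ?t = "\<lambda>i. mul (fls_nth f i) (int_funpow i \<sigma> (fls_nth g (k - i)))"
  have z: "int_funpow i \<sigma> 0 = 0" for i
    using additive.zero[OF additive_int_funpow[OF assms(1,2)]] .
  let ?D = "{max n (fls_subdegree f)..k - max m (fls_subdegree g)}"
  have "(\<Sum>i = fls_subdegree f..k - fls_subdegree g. ?t i) = (\<Sum>i\<in>?D. ?t i)"
  proof (rule sum.mono_neutral_right)
    show "\<forall>i\<in>{fls_subdegree f..k - fls_subdegree g} - ?D. ?t i = 0"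
    proof
      fix i assume "i \<in> {fls_subdegree f..k - fls_subdegree g} - ?D"
      then have "i < n \<or> k - i < m" by auto
      then show "?t i = 0" by (auto simp: f g z mult_0_left mult_0_right)
    qed
  qed auto
  also have "\<dots> = (\<Sum>i = n..k - m. ?t i)"
  proof (rule sum.mono_neutral_left)
    show "\<forall>i\<in>{n..k - m} - ?D. ?t i = 0"
    proof
      fix i assume "i \<in> {n..k - m} - ?D"
      then have "i < fls_subdegree f \<or> k - i < fls_subdegree g" by auto
      then show "?t i = 0" by (auto simp: z mult_0_left mult_0_right)
    qed
  qed auto
  finally show ?thesis by (simp add: fls_nth_skew_fls_mult)
qed

lemma nonassoc_ring_1_skew_fls:
  assumes \<sigma>: "additive \<sigma>" "bij \<sigma>" and "\<sigma> one = one"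
  shows "nonassoc_ring_1 (skew_fls_mult mul \<sigma>) (fls_const one)"
proof
  note add = additive.add[OF additive_int_funpow[OF \<sigma>]]
  fix f g h :: "'a fls"
  obtain nf where nf: "\<And>i. i < nf \<Longrightarrow> fls_nth f i = 0"
    by (meson fls_eq0_below_subdegree)
  define m where "m = min (fls_subdegree g) (fls_subdegree h)"
  have m: "\<And>i. i < m \<Longrightarrow> fls_nth g i = 0" "\<And>i. i < m \<Longrightarrow> fls_nth h i = 0"
    "\<And>i. i < m \<Longrightarrow> fls_nth (g + h) i = 0"
    by (auto simp: m_def)
  show "skew_fls_mult mul \<sigma> f (g + h) = skew_fls_mult mul \<sigma> f g + skew_fls_mult mul \<sigma> f h"
    using nf m
    by (intro fls_eqI)
       (simp add: fls_nth_skew_fls_mult_bounds[OF \<sigma>, of nf _ m] add distrib_left sum.distrib)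
  define l where "l = min (fls_subdegree f) (fls_subdegree g)"
  have l: "\<And>i. i < l \<Longrightarrow> fls_nth f i = 0" "\<And>i. i < l \<Longrightarrow> fls_nth g i = 0"
    "\<And>i. i < l \<Longrightarrow> fls_nth (f + g) i = 0"
    by (auto simp: l_def)
  show "skew_fls_mult mul \<sigma> (f + g) h = skew_fls_mult mul \<sigma> f h + skew_fls_mult mul \<sigma> g h"
    using l m(2)
    by (intro fls_eqI)
       (simp add: fls_nth_skew_fls_mult_bounds[OF \<sigma>, of l _ m] distrib_right sum.distrib)
  show "skew_fls_mult mul \<sigma> (fls_const one) f = f"
  proof (rule fls_eqI)
    fix k
    have "mul (fls_nth (fls_const one) i) (int_funpow i \<sigma> (fls_nth f (k - i)))
      = (if i = 0 then fls_nth f k else 0)" for i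
      by (auto simp: one_left mult_0_left int_funpow_def)
    then have "fls_nth (skew_fls_mult mul \<sigma> (fls_const one) f) k
      = (\<Sum>i = 0..k - nf. if i = 0 then fls_nth f k else 0)"
      using nf by (subst fls_nth_skew_fls_mult_bounds[OF \<sigma>, of 0 _ nf]) simp_all
    then show "fls_nth (skew_fls_mult mul \<sigma> (fls_const one) f) k = fls_nth f k"
      using nf[of k] by auto
  qed
  show "skew_fls_mult mul \<sigma> f (fls_const one) = f"
  proof (rule fls_eqI)
    fix k
    have z: "int_funpow i \<sigma> 0 = 0" for i
      using additive.zero[OF additive_int_funpow[OF \<sigma>]] .
    have "mul (fls_nth f i) (int_funpow i \<sigma> (fls_nth (fls_const one) (k - i)))
      = (if i = k then fls_nth f k else 0)" for i
      by (auto simp: one_right mult_0_right z int_funpow_fixpoint[OF \<sigma>(2) assms(3)])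
    then have "fls_nth (skew_fls_mult mul \<sigma> f (fls_const one)) k
      = (\<Sum>i = nf..k - 0. if i = k then fls_nth f k else 0)"
      using nf by (subst fls_nth_skew_fls_mult_bounds[OF \<sigma>, of nf _ 0]) simp_all
    then show "fls_nth (skew_fls_mult mul \<sigma> f (fls_const one)) k = fls_nth f k"
      using nf[of k] by auto
  qed
qed

end

end

(* To a right ideal J of R((X;sigma)) attach the right ideal of R formed by the leading coefficients
   of its elements; multiplying by a power of X moves the leading term to degree 0. In a right
   Noetherian, right quasi-associative ring this ideal is a finite sum of sets aR. Lift each generator
   a to a series f_a in J with constant term a and no negative powers of X. Then any g in a right
   ideal containing J with the same leading ideal can be written degree by degree as the sum of the
   products f_a h_a. Each f_a has a single right factor h_a, so associativity is never needed. Hence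
   an inclusion of right ideals with equal leading ideals is an equality, and the chain condition
   passes from R to R((X;sigma)). *)

theory Submission
  imports Defs
begin

section \<open>Spans and leading coefficients\<close>

text \<open>One right factor per element of \<open>F\<close> is enough, since
  \<open>mul a s + mul a t = mul a (s + t)\<close>. For infinite \<open>F\<close> the sum defaults
  to 0, so the span is then the zero ideal.\<close>

definition right_span :: "('a::ab_group_add \<Rightarrow> 'a \<Rightarrow> 'a) \<Rightarrow> 'a set \<Rightarrow> 'a set" where
  "right_span mul F = {\<Sum>a\<in>F. mul a (s a) | s. True}"

text \<open>The coefficient in degree 0 is allowed to vanish, which puts 0 into the set and makes
  closure under addition immediate.\<close>

definition leading_ideal :: "'a::ab_group_add fls set \<Rightarrow> 'a set" where
  "leading_ideal J = {fls_nth f 0 | f. f \<in> J \<and> (\<forall>i<0. fls_nth f i = 0)}"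

lemma leading_ideal_mono: "J \<subseteq> K \<Longrightarrow> leading_ideal J \<subseteq> leading_ideal K"
  by (auto simp: leading_ideal_def)

lemma right_ideal_sum:
  assumes "right_ideal mul I" "\<And>a. a \<in> A \<Longrightarrow> f a \<in> I"
  shows "sum f A \<in> I"
  using assms(2) by (induction A rule: infinite_finite_induct)
    (use assms(1) in \<open>auto simp: right_ideal_def\<close>)

lemma right_ideal_diff:
  assumes "right_ideal mul I" "a \<in> I" "b \<in> I"
  shows "a - b \<in> I"
  using assms unfolding right_ideal_def by (metis uminus_add_conv_diff add.commute)

section \<open>Finite generation of right ideals of R\<close>

context nonassoc_ring_1
begin

lemma mult_minus_right: "mul a (- b) = - mul a b"
  using distrib_left[of a b "- b"] by (simp add: mult_0_right eq_neg_iff_add_eq_0 add.commute)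

lemma mult_sum_left: "mul (sum f A) b = (\<Sum>a\<in>A. mul (f a) b)"
  by (induction A rule: infinite_finite_induct) (auto simp: mult_0_left distrib_right)

text \<open>Quasi-associativity rewrites each \<open>mul (mul a (s a)) r\<close> as a product with
  the same left factor \<open>a\<close>, so multiplying by \<open>r\<close> only changes the right
  factors.\<close>

lemma right_ideal_right_span:
  assumes "right_quasi_associative mul"
  shows "right_ideal mul (right_span mul F)"
  unfolding right_ideal_def
proof (intro conjI ballI allI)
  show "0 \<in> right_span mul F"
    unfolding right_span_def by (auto simp: mult_0_right intro!: exI[of _ "\<lambda>_. 0"])
next
  fix a b assume "a \<in> right_span mul F" "b \<in> right_span mul F"
  then obtain s t where "a = (\<Sum>a\<in>F. mul a (s a))" "b = (\<Sum>a\<in>F. mul a (t a))"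
    unfolding right_span_def by auto
  then have "a + b = (\<Sum>a\<in>F. mul a (s a + t a))"
    by (simp add: distrib_left sum.distrib)
  then show "a + b \<in> right_span mul F"
    unfolding right_span_def by (auto intro!: exI[of _ "\<lambda>a. s a + t a"])
next
  fix a assume "a \<in> right_span mul F"
  then obtain s where "a = (\<Sum>a\<in>F. mul a (s a))"
    unfolding right_span_def by auto
  then have "- a = (\<Sum>a\<in>F. mul a (- s a))"
    by (simp add: mult_minus_right sum_negf)
  then show "- a \<in> right_span mul F"
    unfolding right_span_def by (auto intro!: exI[of _ "\<lambda>a. - s a"])
next
  fix a r assume "a \<in> right_span mul F"
  then obtain s where s: "a = (\<Sum>a\<in>F. mul a (s a))"
    unfolding right_span_def by auto
  have "\<forall>a. \<exists>t. mul (mul a (s a)) r = mul a t"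
    using assms unfolding right_quasi_associative_def by blast
  then obtain t where "\<And>a. mul (mul a (s a)) r = mul a (t a)"
    by metis
  then have "mul a r = (\<Sum>a\<in>F. mul a (t a))"
    by (simp add: s mult_sum_left)
  then show "mul a r \<in> right_span mul F"
    unfolding right_span_def by auto
qed

lemma right_span_superset:
  assumes "finite F" "a \<in> F"
  shows "a \<in> right_span mul F"
proof -
  have "mul b (if b = a then one else 0) = (if b = a then b else 0)" for b
    by (simp add: one_right mult_0_right)
  then have "(\<Sum>b\<in>F. mul b (if b = a then one else 0)) = a"
    using assms by simp
  then show ?thesis
    unfolding right_span_def by (auto intro!: exI[of _ "\<lambda>b. if b = a then one else 0"])
qed

lemma right_span_subset:
  assumes "right_ideal mul I" "F \<subseteq> I"
  shows "right_span mul F \<subseteq> I"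
proof
  fix x assume "x \<in> right_span mul F"
  then obtain s where "x = (\<Sum>a\<in>F. mul a (s a))"
    unfolding right_span_def by auto
  moreover have "mul a (s a) \<in> I" if "a \<in> F" for a
    using that assms by (auto simp: right_ideal_def)
  ultimately show "x \<in> I"
    using right_ideal_sum[OF assms(1), of F "\<lambda>a. mul a (s a)"] by simp
qed

text \<open>Otherwise one can keep adjoining an element of \<open>I\<close> outside the span reached
  so far. Quasi-associativity makes these spans right ideals, and they would increase strictly
  forever.\<close>

lemma right_ideal_finitely_generated:
  assumes "right_noetherian mul" "right_quasi_associative mul" "right_ideal mul I"
  shows "\<exists>F. finite F \<and> right_span mul F = I"
proof (rule ccontr)
  assume "\<nexists>F. finite F \<and> right_span mul F = I"
  then have nofin: "\<And>F. finite F \<Longrightarrow> right_span mul F \<noteq> I"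
    by blast
  have "\<exists>F'. (finite F' \<and> F' \<subseteq> I) \<and> (\<exists>a. a \<notin> right_span mul F \<and> F' = insert a F)"
    if F: "finite F \<and> F \<subseteq> I" for F
  proof -
    obtain a where "a \<in> I" "a \<notin> right_span mul F"
      using nofin[of F] F right_span_subset[OF assms(3), of F] by blast
    with F show ?thesis by (intro exI[of _ "insert a F"]) auto
  qed
  then have "\<exists>G. \<forall>n. (finite (G n) \<and> G n \<subseteq> I) \<and>
      (\<exists>a. a \<notin> right_span mul (G n) \<and> G (Suc n) = insert a (G n))"
    by (intro dependent_nat_choice) auto
  then obtain G where G: "\<And>n. finite (G n)"
    and step: "\<And>n. \<exists>a. a \<notin> right_span mul (G n) \<and> G (Suc n) = insert a (G n)"
    by metis
  note ideal = right_ideal_right_span[OF assms(2)]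
  have "right_span mul (G n) \<subseteq> right_span mul (G (Suc n))" for n
  proof (rule right_span_subset[OF ideal])
    show "G n \<subseteq> right_span mul (G (Suc n))"
      using step[of n] right_span_superset[OF G[of "Suc n"]] by auto
  qed
  then have "\<exists>N. \<forall>n\<ge>N. right_span mul (G n) = right_span mul (G N)"
    using assms(1)[unfolded right_noetherian_def, rule_format, of "\<lambda>n. right_span mul (G n)"] ideal
    by simp
  then obtain N where "right_span mul (G (Suc N)) = right_span mul (G N)"
    by (meson le_SucI order_refl)
  then show False
    using step[of N] right_span_superset[OF G[of "Suc N"]] by blast
qed

section \<open>Lowest terms of skew products\<close>

context
  fixes \<sigma> :: "'a \<Rightarrow> 'a"
  assumes \<sigma>: "additive \<sigma>" "bij \<sigma>" and \<sigma>_one: "\<sigma> one = one"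
begin

abbreviation skew_mul :: "'a fls \<Rightarrow> 'a fls \<Rightarrow> 'a fls" (infixl \<open>\<star>\<close> 70) where
  "f \<star> g \<equiv> skew_fls_mult mul \<sigma> f g"

interpretation skew: nonassoc_ring_1 "skew_fls_mult mul \<sigma>" "fls_const one"
  by (rule nonassoc_ring_1_skew_fls[OF \<sigma> \<sigma>_one])

lemma skew_mul_below:
  assumes "\<And>i. i < n \<Longrightarrow> fls_nth f i = 0" "\<And>j. j < m \<Longrightarrow> fls_nth g j = 0" "k < n + m"
  shows "fls_nth (f \<star> g) k = 0"
  using assms(3) by (subst fls_nth_skew_fls_mult_bounds[OF \<sigma> assms(1,2)]) auto

text \<open>In degree \<open>n + m\<close> the summation range shrinks to the single index
  \<open>n\<close>.\<close>

lemma skew_mul_lead: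
  assumes "\<And>i. i < n \<Longrightarrow> fls_nth f i = 0" "\<And>j. j < m \<Longrightarrow> fls_nth g j = 0"
  shows "fls_nth (f \<star> g) (n + m) = mul (fls_nth f n) (int_funpow n \<sigma> (fls_nth g m))"
  by (subst fls_nth_skew_fls_mult_bounds[OF \<sigma> assms]) auto

text \<open>By left distributivity the two products differ by \<open>f \<star> (g - h)\<close>,
  which starts in degree \<open>k + 1\<close> or later. This is the continuity used to pass to a
  limit in the right factor.\<close>

lemma skew_mul_cong_upto:
  assumes "\<And>i. i < 0 \<Longrightarrow> fls_nth f i = 0" "\<And>j. j \<le> k \<Longrightarrow> fls_nth g j = fls_nth h j"
  shows "fls_nth (f \<star> g) k = fls_nth (f \<star> h) k"
proof -
  have "fls_nth (f \<star> (g - h)) k = 0"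
    using assms by (intro skew_mul_below[of 0 _ "k + 1"]) auto
  moreover have "f \<star> g = f \<star> (g - h) + f \<star> h"
    using skew.distrib_left[of f "g - h" h] by simp
  ultimately show ?thesis by simp
qed

section \<open>Leading ideals\<close>

lemma leading_coeff_in_leading_ideal:
  assumes "right_ideal (skew_fls_mult mul \<sigma>) J" "g \<in> J" "\<And>i. i < n \<Longrightarrow> fls_nth g i = 0"
  shows "fls_nth g n \<in> leading_ideal J"
proof -
  \<comment> \<open>The right factor is \<open>X^(-n)\<close>; since \<sigma> fixes
    \<open>one\<close>, multiplying by it leaves the coefficient \<open>fls_nth g n\<close>
    unchanged.\<close>
  let ?f = "g \<star> fls_shift n (fls_const one)"
  have z: "fls_nth (fls_shift n (fls_const one)) j = 0" if "j < - n" for j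
    using that by simp
  have "?f \<in> J" using assms(1,2) by (simp add: right_ideal_def)
  moreover have "\<forall>i<0. fls_nth ?f i = 0"
    using skew_mul_below[OF assms(3) z] by simp
  moreover have "fls_nth ?f 0 = fls_nth g n"
    using skew_mul_lead[of n g "- n", OF assms(3) z] by (simp add: int_funpow_fixpoint[OF \<sigma>(2) \<sigma>_one] one_right)
  ultimately show ?thesis unfolding leading_ideal_def by force
qed

lemma right_ideal_leading_ideal:
  assumes J: "right_ideal (skew_fls_mult mul \<sigma>) J"
  shows "right_ideal mul (leading_ideal J)"
  unfolding right_ideal_def
proof (intro conjI ballI allI)
  show "0 \<in> leading_ideal J"
    using J unfolding leading_ideal_def right_ideal_def by (auto intro!: exI[of _ 0])
next
  fix a b assume "a \<in> leading_ideal J" "b \<in> leading_ideal J"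
  then obtain f g where "f \<in> J" "g \<in> J" "\<forall>i<0. fls_nth f i = 0" "\<forall>i<0. fls_nth g i = 0"
    "a = fls_nth f 0" "b = fls_nth g 0"
    unfolding leading_ideal_def by auto
  with J show "a + b \<in> leading_ideal J"
    unfolding leading_ideal_def right_ideal_def by (auto intro!: exI[of _ "f + g"])
next
  fix a assume "a \<in> leading_ideal J"
  then obtain f where "f \<in> J" "\<forall>i<0. fls_nth f i = 0" "a = fls_nth f 0"
    unfolding leading_ideal_def by auto
  with J show "- a \<in> leading_ideal J"
    unfolding leading_ideal_def right_ideal_def by (auto intro!: exI[of _ "- f"])
next
  fix a r :: 'a assume "a \<in> leading_ideal J"
  then obtain f where f: "f \<in> J" "\<And>i. i < 0 \<Longrightarrow> fls_nth f i = 0" "a = fls_nth f 0"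
    unfolding leading_ideal_def by auto
  have z: "fls_nth (fls_const r) j = 0" if "j < 0" for j
    using that by simp
  \<comment> \<open>The constant \<open>r\<close> meets the coefficient of \<open>f\<close> in
    degree 0, where the twist is the identity.\<close>
  have "f \<star> fls_const r \<in> J" using J f(1) by (simp add: right_ideal_def)
  moreover have "\<forall>i<0. fls_nth (f \<star> fls_const r) i = 0"
    using skew_mul_below[OF f(2) z] by simp
  moreover have "fls_nth (f \<star> fls_const r) 0 = mul a r"
    using skew_mul_lead[of 0 f 0 "fls_const r", OF f(2) z] by (simp add: f(3) int_funpow_def)
  ultimately show "mul a r \<in> leading_ideal J"
    unfolding leading_ideal_def by force
qed

section \<open>Division by lifts of the generators\<close>

text \<open>Each stage kills the lowest remaining coefficient of the remainder. It changes the right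
  factors in one new degree only, so they converge coefficientwise.\<close>

lemma successive_division:
  fixes f :: "'a \<Rightarrow> 'a fls"
  assumes J: "right_ideal (skew_fls_mult mul \<sigma>) J"
    and lead: "leading_ideal J \<subseteq> right_span mul F"
    and fJ: "\<And>a. a \<in> F \<Longrightarrow> f a \<in> J"
    and f_below: "\<And>a i. a \<in> F \<Longrightarrow> i < 0 \<Longrightarrow> fls_nth (f a) i = 0"
    and f_0: "\<And>a. a \<in> F \<Longrightarrow> fls_nth (f a) 0 = a"
    and g: "g \<in> J"
  shows "\<exists>h. g = (\<Sum>a\<in>F. f a \<star> h a)"
proof -
  \<comment> \<open>A lower bound common to all right factors at all stages; it keeps their limits
    Laurent series.\<close>
  define n where "n = fls_subdegree g"
  \<comment> \<open>\<open>P\<close> is the invariant after \<open>k\<close> divisions;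
    \<open>Q\<close> says that the next division leaves the settled coefficients alone.\<close>
  define P where "P k h \<longleftrightarrow> (\<forall>a i. i < n \<longrightarrow> fls_nth (h a) i = 0) \<and>
      (\<forall>i<n + int k. fls_nth (g - (\<Sum>a\<in>F. f a \<star> h a)) i = 0)" for k h
  define Q where "Q k h h' \<longleftrightarrow> (\<forall>a. \<forall>i<n + int k. fls_nth (h' a) i = fls_nth (h a) i)"
    for k and h h' :: "'a \<Rightarrow> 'a fls"
  have base: "P 0 (\<lambda>_. 0)"
    by (simp add: P_def n_def skew.mult_0_right)
  have step: "\<exists>h'. P (Suc k) h' \<and> Q k h h'" if h: "P k h" for k h
  proof -
    let ?m = "n + int k"
    let ?r = "g - (\<Sum>a\<in>F. f a \<star> h a)"
    have "f a \<star> h a \<in> J" if "a \<in> F" for a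
      using fJ[OF that] J by (simp add: right_ideal_def)
    then have "?r \<in> J"
      by (intro right_ideal_diff[OF J g] right_ideal_sum[OF J])
    moreover have r_below: "fls_nth ?r i = 0" if "i < ?m" for i
      using h that unfolding P_def by blast
    ultimately have "fls_nth ?r ?m \<in> right_span mul F"
      using leading_coeff_in_leading_ideal[OF J] lead by blast
    then obtain s where s: "fls_nth ?r ?m = (\<Sum>a\<in>F. mul a (s a))"
      unfolding right_span_def by blast
    \<comment> \<open>The monomial \<open>s a X^m\<close> with \<open>m = n + k\<close>. As
      \<open>f a\<close> starts with \<open>a\<close> in degree 0, the product
      \<open>f a \<star> e a\<close> starts with the untwisted \<open>mul a (s a)\<close> in degree
      \<open>m\<close>.\<close>
    define e where "e a = fls_shift (- ?m) (fls_const (s a))" for a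
    have e_nth: "fls_nth (e a) i = (if i = ?m then s a else 0)" for a i
      by (simp add: e_def)
    have e_below: "fls_nth (f a \<star> e a) i = 0" if "a \<in> F" "i < ?m" for a i
      using skew_mul_below[of 0 "f a" ?m "e a" i] f_below[OF that(1)] that(2) by (simp add: e_nth)
    have e_lead: "fls_nth (f a \<star> e a) ?m = mul a (s a)" if "a \<in> F" for a
      using skew_mul_lead[of 0 "f a" ?m "e a"] f_below[OF that] f_0[OF that]
      by (simp add: e_nth int_funpow_def)
    let ?h = "\<lambda>a. h a + e a"
    \<comment> \<open>Left distributivity absorbs the correction into the right factor of the same
      \<open>f a\<close>.\<close>
    have split: "g - (\<Sum>a\<in>F. f a \<star> ?h a) = ?r - (\<Sum>a\<in>F. f a \<star> e a)"
      by (simp add: skew.distrib_left sum.distrib)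
    have "fls_nth (g - (\<Sum>a\<in>F. f a \<star> ?h a)) i = 0" if "i < n + int (Suc k)" for i
    proof (cases "i = ?m")
      case True
      have "fls_nth (\<Sum>a\<in>F. f a \<star> e a) ?m = (\<Sum>a\<in>F. mul a (s a))"
        by (simp add: fls_nth_sum e_lead)
      then show ?thesis using s True unfolding split by simp
    next
      case False
      with that have "i < ?m" by simp
      moreover from this have "fls_nth (\<Sum>a\<in>F. f a \<star> e a) i = 0"
        by (simp add: fls_nth_sum e_below)
      ultimately show ?thesis using r_below[of i] unfolding split by simp
    qed
    then have "P (Suc k) ?h"
      using h unfolding P_def by (auto simp: e_nth)
    moreover have "Q k h ?h"
      by (simp add: Q_def e_nth)
    ultimately show ?thesis by blast
  qed
  obtain H where P: "\<And>k. P k (H k)" and Q: "\<And>k. Q k (H k) (H (Suc k))"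
    using dependent_nat_choice[of P Q] base step by blast
  have stable: "fls_nth (H l a) i = fls_nth (H k a) i" if "k \<le> l" "i < n + int k" for k l a i
    using that(1)
  proof (induction l rule: dec_induct)
    case base
    show ?case by simp
  next
    case (step l)
    then have "fls_nth (H (Suc l) a) i = fls_nth (H l a) i"
      using Q[of l] that(2) unfolding Q_def by simp
    with step show ?case by simp
  qed
  \<comment> \<open>Coefficient \<open>i\<close> is settled from stage \<open>i - n + 1\<close> on,
    the first \<open>k\<close> with \<open>i < n + int k\<close>. For \<open>i < n\<close> the
    truncation by \<open>nat\<close> picks stage 0, where it is zero.\<close>
  define h where "h a = Abs_fls (\<lambda>i. fls_nth (H (nat (i - n + 1)) a) i)" for a
  have h_nth: "fls_nth (h a) i = fls_nth (H (nat (i - n + 1)) a) i" for a i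
    unfolding h_def using P unfolding P_def by (intro nth_Abs_fls_lower_bound[of n]) auto
  have h_H: "fls_nth (h a) i = fls_nth (H k a) i" if "i < n + int k" for a i k
  proof (cases "i < n")
    case True
    then show ?thesis using P unfolding P_def h_nth by auto
  next
    case False
    then show ?thesis
      using stable[of "nat (i - n + 1)" k i a] that unfolding h_nth by simp
  qed
  have "fls_nth (\<Sum>a\<in>F. f a \<star> h a) i = fls_nth g i" for i
  proof -
    \<comment> \<open>Degree \<open>i\<close> of the products sees the right factors only up to
      degree \<open>i\<close>, so the limit may be replaced by stage \<open>k\<close>.\<close>
    define k where "k = nat (i - n + 1)"
    have k: "i < n + int k" by (simp add: k_def)
    have "fls_nth (f a \<star> h a) i = fls_nth (f a \<star> H k a) i" if "a \<in> F" for a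
      using f_below[OF that] h_H k by (intro skew_mul_cong_upto) auto
    then have "fls_nth (\<Sum>a\<in>F. f a \<star> h a) i = fls_nth (\<Sum>a\<in>F. f a \<star> H k a) i"
      by (simp add: fls_nth_sum)
    moreover have "fls_nth (g - (\<Sum>a\<in>F. f a \<star> H k a)) i = 0"
      using P k unfolding P_def by blast
    ultimately show ?thesis by simp
  qed
  then have "g = (\<Sum>a\<in>F. f a \<star> h a)"
    by (intro fls_eqI) simp
  then show ?thesis by blast
qed

section \<open>Transfer of the chain condition\<close>

lemma right_ideal_eq_if_leading_ideal_eq:
  assumes "right_noetherian mul" "right_quasi_associative mul"
    and J: "right_ideal (skew_fls_mult mul \<sigma>) J" and K: "right_ideal (skew_fls_mult mul \<sigma>) K"
    and "J \<subseteq> K" "leading_ideal J = leading_ideal K"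
  shows "J = K"
proof
  obtain F where F: "finite F" "right_span mul F = leading_ideal J"
    using right_ideal_finitely_generated[OF assms(1,2) right_ideal_leading_ideal[OF J]] by blast
  have "\<exists>f. f \<in> J \<and> (\<forall>i<0. fls_nth f i = 0) \<and> fls_nth f 0 = a" if "a \<in> F" for a
    using right_span_superset[OF F(1) that] unfolding F(2) leading_ideal_def by auto
  then obtain f where f: "\<And>a. a \<in> F \<Longrightarrow> f a \<in> J"
    "\<And>a i. a \<in> F \<Longrightarrow> i < 0 \<Longrightarrow> fls_nth (f a) i = 0" "\<And>a. a \<in> F \<Longrightarrow> fls_nth (f a) 0 = a"
    by metis
  show "K \<subseteq> J"
  proof
    fix g assume "g \<in> K"
    \<comment> \<open>The division takes place in \<open>K\<close>, but the lifts \<open>f a\<close>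
      were chosen in the smaller ideal \<open>J\<close>; hence the resulting sum lies in
      \<open>J\<close>.\<close>
    then obtain h where "g = (\<Sum>a\<in>F. f a \<star> h a)"
      using successive_division[OF K _ _ f(2,3), of F g] f(1) F(2) assms(5,6) by auto
    moreover have "f a \<star> h a \<in> J" if "a \<in> F" for a
      using f(1)[OF that] J by (simp add: right_ideal_def)
    ultimately show "g \<in> J"
      using right_ideal_sum[OF J, of F "\<lambda>a. f a \<star> h a"] by simp
  qed
qed (rule assms)

lemma right_noetherian_skew_fls:
  assumes "right_noetherian mul" "right_quasi_associative mul"
  shows "right_noetherian (skew_fls_mult mul \<sigma>)"
  unfolding right_noetherian_def
proof (intro allI impI)
  fix J :: "nat \<Rightarrow> 'a fls set"
  assume "(\<forall>n. right_ideal (skew_fls_mult mul \<sigma>) (J n)) \<and> (\<forall>n. J n \<subseteq> J (Suc n))"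
  then have J: "\<And>n. right_ideal (skew_fls_mult mul \<sigma>) (J n)" and inc: "\<And>n. J n \<subseteq> J (Suc n)"
    by auto
  have "\<And>n. right_ideal mul (leading_ideal (J n))"
    using right_ideal_leading_ideal[OF J] .
  moreover have "\<And>n. leading_ideal (J n) \<subseteq> leading_ideal (J (Suc n))"
    using leading_ideal_mono[OF inc] .
  ultimately have "\<exists>N. \<forall>n\<ge>N. leading_ideal (J n) = leading_ideal (J N)"
    using assms(1)[unfolded right_noetherian_def, rule_format, of "\<lambda>n. leading_ideal (J n)"]
    by simp
  then obtain N where N: "\<And>n. n \<ge> N \<Longrightarrow> leading_ideal (J n) = leading_ideal (J N)"
    by blast
  \<comment> \<open>The chain in the Laurent series ring stops as soon as its leading ideals
    do.\<close>
  have "J N = J n" if "n \<ge> N" for n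
    using right_ideal_eq_if_leading_ideal_eq[OF assms J J lift_Suc_mono_le[of J, OF inc that]] N[OF that]
    by simp
  then show "\<exists>N. \<forall>n\<ge>N. J n = J N" by metis
qed

end

end

theorem corollary3p22:
  fixes mul :: "'a::ab_group_add \<Rightarrow> 'a \<Rightarrow> 'a"
    and one :: 'a
    and \<sigma> :: "'a \<Rightarrow> 'a"
  assumes "nonassoc_ring_1 mul one"
    and "additive \<sigma>"
    and "bij \<sigma>"
    and "\<sigma> one = one"
    and "right_noetherian mul"
    and "right_quasi_associative mul"
  shows "right_noetherian (skew_fls_mult mul \<sigma>)"
  using nonassoc_ring_1.right_noetherian_skew_fls[OF assms] .

end
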